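(* For any positive integer $\ell$, the following strong $\mathcal W_{[\ell]}$-Wilf-equivalences hold (write $\sim_*$ for $\overset{\mathcal W_{[\ell]}}{\sim_*}$): (i) $13-12\sim_* 12-13$; (ii) $12-23\sim_* 21-32$; (iii) $13-24\sim_* 24-13$; (iv) $123-1\sim_* 321-1\sim_* 123-3$; (v) $124-3\sim_* 421-3\sim_* 134-2$; (vi) $1-12-2\sim_* 1-21-2$; (vii) $1-13-2\sim_* 1-31-2$; (viii) $2-14-3\sim_* 2-41-3$; (ix) $12-1-1\sim_* 21-1-1\sim_* 12-2-2$.
   Context: For a positive integer $\ell$, $\mathcal W_{[\ell]}=\bigsqcup_{n\ge0}\mathcal W_{[\ell];n}$ is the collection of $\ell$-ary words, i.e. words with letters in $\{1,\ldots,\ell\}$; $\mathcal W_{[\ell];n}$ is the set of those of length $n$. A dashed pattern $p$ of length $m$ is a word $p_1\cdots p_m$ whose set of letters is exactly $\{1,\dots,r\}$ for some $r\geq1$, in which two adjacent letters may or may not be separated by a dash. An occurrence of $p$ in a word $w=w_1\cdots w_n$ of positive integers is a choice of positions $1\le i_1<\dots<i_m\le n$ such that $w_{i_s}>w_{i_t}$ if and only if $p_s>p_t$ for all $s,t$, and $i_{s+1}=i_s+1$ whenever $p_s$ and $p_{s+1}$ are not separated by a dash. In the patterns listed, each digit is a letter (e.g. $124-3$ has letters $1,2,4,3$ with a dash only between $4$ and $3$). For a collection $\mathcal F=\bigsqcup_n\mathcal F_n$ of words ($\mathcal F_n$ being the words of length $n$), two patterns $p,q$ are strongly $\mathcal F$-Wilf-equivalent,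 written $p\overset{\mathcal F}{\sim_*}q$, if for all $n,k\ge0$ the number of words in $\mathcal F_n$ with exactly $k$ occurrences of $p$ equals the number with exactly $k$ occurrences of $q$. *)

theory Defs
  imports Main
begin

text \<open>A dashed pattern is given as the list of its maximal dash-free blocks; the pattern
  124-3 is \<open>[[1,2,4],[3]]\<close>.\<close>

type_synonym dashed_pattern = "nat list list"

definition letters :: "dashed_pattern \<Rightarrow> nat list" where
  "letters p = concat p"

definition is_dashed_pattern :: "dashed_pattern \<Rightarrow> bool" where
  "is_dashed_pattern p \<longleftrightarrow> [] \<notin> set p \<and> (\<exists>r\<ge>1. set (letters p) = {1..r})"

text \<open>The number of letters to the left of each dash: with 0-based indices, \<open>Suc s\<close> belongs
  to this set iff a dash separates the letters at positions \<open>s\<close> and \<open>Suc s\<close>.\<close>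

definition dashes :: "dashed_pattern \<Rightarrow> nat set" where
  "dashes p = {length (letters (take j p)) | j. 0 < j \<and> j < length p}"

text \<open>Occurrences are lists of 0-based positions in \<open>w\<close>.\<close>

definition occurrences :: "dashed_pattern \<Rightarrow> nat list \<Rightarrow> nat list set" where
  "occurrences p w =
     {is. length is = length (letters p) \<and> sorted_wrt (<) is \<and> set is \<subseteq> {..<length w} \<and>
          (\<forall>s < length (letters p). \<forall>t < length (letters p).
             w ! (is ! s) > w ! (is ! t) \<longleftrightarrow> letters p ! s > letters p ! t) \<and>
          (\<forall>s. Suc s < length (letters p) \<and> Suc s \<notin> dashes p \<longrightarrow> is ! Suc s = Suc (is ! s))}"

definition words :: "nat \<Rightarrow> nat list set" where
  "words l = lists {1..l}"

text \<open>Meant for collections \<open>F\<close> with finitely many words of each length, such as \<open>words l\<close>.\<close>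

definition strongly_Wilf_equivalent ::
    "nat list set \<Rightarrow> dashed_pattern \<Rightarrow> dashed_pattern \<Rightarrow> bool" where
  "strongly_Wilf_equivalent F p q \<longleftrightarrow>
     (\<forall>n k. card {w \<in> F. length w = n \<and> card (occurrences p w) = k} =
            card {w \<in> F. length w = n \<and> card (occurrences q w) = k})"

lemma finite_occurrences: "finite (occurrences p w)"
proof (rule finite_subset)
  show "occurrences p w \<subseteq> {is. set is \<subseteq> {..<length w} \<and> length is = length (letters p)}"
    by (auto simp: occurrences_def)
qed (rule finite_lists_length_eq, simp)

lemma finite_words_length: "finite {w \<in> words l. length w = n}"
proof (rule finite_subset)
  show "{w \<in> words l. length w = n} \<subseteq> {w. set w \<subseteq> {1..l} \<and> length w = n}"
    by (auto simp: words_def)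
qed (rule finite_lists_length_eq, simp)

end

theory Submission
  imports Defs
begin

text \<open>All equivalences reduce to one: if the dash-free blocks of p are strictly increasing and the
  letter ranges of consecutive blocks overlap, then p is equivalent to the pattern with the same
  blocks in reverse order. Indeed, consecutive blocks then never occur in the same increasing run
  of a word. Reversing the order of the maximal increasing runs of a word may create new ascents
  between runs; by inclusion-exclusion one sums instead, with signs, over arbitrary sequences of
  increasing words in which some ascents are declared unusable. On such sequences reversal is a
  sign-preserving bijection that reverses the order of the blocks in every occurrence. The symmetries
  of words under reversal and complementation yield the rest.\<close>

section \<open>Order isomorphism between a pattern and lists of values\<close>

text \<open>Apart from the block lengths, only the set of pairs (pattern letter, value) matters, not
  their order; rearranging pattern and values in the same way therefore changes nothing. Since all
  ordered pairs are compared, the single relation \<open><\<close> also settles equalities.\<close>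

definition order_iso :: "nat list list \<Rightarrow> nat list list \<Rightarrow> bool" where
  "order_iso p vs \<longleftrightarrow> map length vs = map length p \<and>
     (\<forall>(a, b) \<in> set (zip (concat p) (concat vs)).
      \<forall>(c, d) \<in> set (zip (concat p) (concat vs)). b < d \<longleftrightarrow> a < c)"

lemma zip_concat:
  "map length vs = map length p \<Longrightarrow> zip (concat p) (concat vs) = concat (map2 zip p vs)"
proof (induction p arbitrary: vs)
  case (Cons b p)
  then show ?case by (cases vs) simp_all
qed simp

lemma order_iso_rev: "order_iso (rev p) (rev vs) \<longleftrightarrow> order_iso p vs"
proof (cases "map length vs = map length p")
  case True
  then have len: "length p = length vs"
    by (rule map_eq_imp_length_eq[symmetric])
  have "map length (rev vs) = map length (rev p)"
    using True by (simp flip: rev_map)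
  moreover have "set (zip (concat (rev p)) (concat (rev vs))) = set (zip (concat p) (concat vs))"
    using True len calculation by (simp add: zip_concat zip_rev)
  ultimately show ?thesis
    using True by (simp add: order_iso_def)
next
  case False
  then show ?thesis by (simp add: order_iso_def flip: rev_map)
qed

lemma order_iso_less:
  assumes "order_iso p vs" "i < length p" "j < length p" "s < length (p ! i)" "t < length (p ! j)"
  shows "vs ! i ! s < vs ! j ! t \<longleftrightarrow> p ! i ! s < p ! j ! t"
proof -
  have len: "map length vs = map length p" using assms(1) by (simp add: order_iso_def)
  then have l: "length vs = length p" by (rule map_eq_imp_length_eq)
  have li: "length (vs ! i) = length (p ! i)" if "i < length p" for i
    using arg_cong[OF len, of "\<lambda>xs. xs ! i"] that l by simp
  have "(p ! i ! s, vs ! i ! s) \<in> set (zip (concat p) (concat vs))"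
    if "i < length p" "s < length (p ! i)" for i s
  proof -
    have "(p ! i, vs ! i) \<in> set (zip p vs)"
      using that l by (auto simp: set_zip)
    moreover have "(p ! i ! s, vs ! i ! s) \<in> set (zip (p ! i) (vs ! i))"
      using that li[of i] by (auto simp: set_zip)
    ultimately show ?thesis by (force simp: zip_concat[OF len])
  qed
  from this[OF assms(2,4)] this[OF assms(3,5)] show ?thesis
    using assms(1) unfolding order_iso_def by blast
qed

section \<open>Occurrences as placements of blocks\<close>

text \<open>Replaces the flat position list and its dash set: each dash-free block becomes an
  interval of positions, so that arguments can handle one block at a time.\<close>

definition placements :: "nat list \<Rightarrow> nat \<Rightarrow> nat list list set" where
  "placements ms n = {iss. map length iss = ms \<and> (\<forall>b \<in> set iss. \<exists>s. b = [s..<s + length b]) \<and>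
     sorted_wrt (<) (concat iss) \<and> set (concat iss) \<subseteq> {..<n}}"

lemma dashes_Cons:
  "dashes (b # p) = (if p = [] then {} else insert (length b) ((+) (length b) ` dashes p))"
proof (cases "p = []")
  case True
  then show ?thesis by (simp add: dashes_def)
next
  case False
  have dashes: "dashes q = (\<lambda>j. length (letters (take j q))) ` {0<..<length q}" for q
    by (auto simp: dashes_def)
  have "{0<..<length (b # p)} = Suc ` {..<length p}"
    unfolding image_Suc_lessThan by auto
  also have "{..<length p} = insert 0 {0<..<length p}"
    using False by (intro set_eqI) auto
  finally have "dashes (b # p) =
     (\<lambda>j. length (letters (take j (b # p)))) ` Suc ` insert 0 {0<..<length p}"
    by (simp only: dashes)
  then show ?thesis
    using False by (simp only: dashes image_image image_insert) (simp add: letters_def)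
qed

lemma consecutive_imp_upt:
  assumes "\<And>s. Suc s < length xs \<Longrightarrow> xs ! Suc s = Suc (xs ! s)"
  shows "\<exists>s. xs = [s..<s + length xs]"
proof (cases xs)
  case Nil
  then show ?thesis by simp
next
  case (Cons x ys)
  have "xs ! i = x + i" if "i < length xs" for i
    using that
  proof (induction i)
    case (Suc i)
    then show ?case using assms[of i] by simp
  qed (simp add: Cons)
  then have "xs = [x..<x + length xs]" by (auto intro: nth_equalityI)
  then show ?thesis ..
qed

text \<open>The adjacency conditions never cross a dash, so they act on each block separately and
  make it an interval. The induction splits off the first block.\<close>

lemma dashed_positions_eq_concat_image:
  assumes "[] \<notin> set p"
  shows "{is. length is = length (letters p) \<and>
       (\<forall>s. Suc s < length (letters p) \<and> Suc s \<notin> dashes p \<longrightarrow> is ! Suc s = Suc (is ! s))} =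
     concat ` {iss. map length iss = map length p \<and> (\<forall>b \<in> set iss. \<exists>s. b = [s..<s + length b])}"
  (is "?A p = concat ` ?B p")
  using assms
proof (induction p)
  case Nil
  then show ?case by (auto simp: letters_def)
next
  case (Cons b p)
  let ?k = "length b"
  have IH: "?A p = concat ` ?B p" using Cons by simp
  have len: "length (letters (b # p)) = ?k + length (letters p)" by (simp add: letters_def)
  have D: "Suc s \<in> dashes (b # p) \<longleftrightarrow> p \<noteq> [] \<and> (Suc s = ?k \<or> (\<exists>d \<in> dashes p. Suc s = ?k + d))" for s
    by (auto simp: dashes_Cons)
  have pos: "0 \<notin> dashes p"
  proof
    assume "0 \<in> dashes p"
    then obtain j where "concat (take j p) = []" "0 < j" "j < length p"
      by (auto simp: dashes_def letters_def)
    then have "hd p = []" "p \<noteq> []" by (cases p; cases j; auto)+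
    then show False using Cons.prems by (metis hd_in_set list.set_intros(2))
  qed
  have eq: "xs @ ys \<in> ?A (b # p) \<longleftrightarrow> (\<exists>s. xs = [s..<s + length xs]) \<and> ys \<in> ?A p"
    if xs: "length xs = ?k" for xs ys
  proof (intro iffI conjI)
    assume A: "xs @ ys \<in> ?A (b # p)"
    show "\<exists>s. xs = [s..<s + length xs]"
    proof (rule consecutive_imp_upt)
      fix s assume s: "Suc s < length xs"
      then have "Suc s \<notin> dashes (b # p)" using xs by (auto simp: D)
      then show "xs ! Suc s = Suc (xs ! s)"
        using A s xs len by (auto simp: nth_append dest!: spec[of _ s])
    qed
    show "ys \<in> ?A p"
    proof (intro CollectI conjI allI impI)
      show l: "length ys = length (letters p)" using A xs len by simp
      fix s assume s: "Suc s < length (letters p) \<and> Suc s \<notin> dashes p"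
      then have "Suc (?k + s) \<notin> dashes (b # p)" using pos by (auto simp: D)
      then have "(xs @ ys) ! Suc (?k + s) = Suc ((xs @ ys) ! (?k + s))"
        using A s len by simp
      then show "ys ! Suc s = Suc (ys ! s)" using xs by (simp add: nth_append)
    qed
  next
    assume B: "(\<exists>s. xs = [s..<s + length xs]) \<and> ys \<in> ?A p"
    then obtain x where x: "xs = [x..<x + length xs]" by blast
    show "xs @ ys \<in> ?A (b # p)"
    proof (intro CollectI conjI allI impI)
      show "length (xs @ ys) = length (letters (b # p))" using B xs len by simp
      fix s assume s: "Suc s < length (letters (b # p)) \<and> Suc s \<notin> dashes (b # p)"
      consider "Suc s < ?k" | "Suc s = ?k" | j where "s = ?k + j"
        by (metis Suc_lessI le_Suc_ex not_less)
      then show "(xs @ ys) ! Suc s = Suc ((xs @ ys) ! s)"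
      proof cases
        case 1
        have "xs ! i = x + i" if "i < ?k" for i
          using that xs x by (metis add_less_cancel_left nth_upt)
        then show ?thesis using xs 1 by (simp add: nth_append)
      next
        \<comment> \<open>At the junction behind the first block there is a dash unless no block
          follows; in that case \<open>Suc s\<close> is already out of range.\<close>
        case 2
        then have "p = []" using s D by blast
        then show ?thesis using s 2 by (simp add: letters_def)
      next
        case 3
        then have j: "Suc j < length (letters p)" using s len by simp
        then have "p \<noteq> []" by (auto simp: letters_def)
        then have "Suc j \<notin> dashes p" using s 3 D[of s] by auto
        then have "ys ! Suc j = Suc (ys ! j)" using B j by blast
        then show ?thesis using xs 3 by (simp add: nth_append)
      qed
    qed
  qed
  show ?case
  proof (rule set_eqI)
    fix ks
    show "ks \<in> ?A (b # p) \<longleftrightarrow> ks \<in> concat ` ?B (b # p)"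
    proof
      assume A: "ks \<in> ?A (b # p)"
      let ?x = "take ?k ks" and ?y = "drop ?k ks"
      have lx: "length ?x = ?k" using A len by simp
      then have "(\<exists>s. ?x = [s..<s + length ?x])" "?y \<in> ?A p"
        using eq[OF lx, of ?y] A by simp_all
      moreover from this(2) obtain iss where "?y = concat iss" "iss \<in> ?B p"
        unfolding IH by blast
      ultimately have "?x # iss \<in> ?B (b # p)" "ks = concat (?x # iss)"
        using lx append_take_drop_id[of ?k ks] by simp_all
      then show "ks \<in> concat ` ?B (b # p)" by blast
    next
      assume "ks \<in> concat ` ?B (b # p)"
      then obtain xs iss where "ks = xs @ concat iss" "length xs = ?k" "iss \<in> ?B p"
         "\<exists>s. xs = [s..<s + length xs]"
        by (auto simp: map_eq_Cons_conv)
      then show "ks \<in> ?A (b # p)" using eq IH by blast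
    qed
  qed
qed

lemma order_iso_iff_nth:
  assumes "map length iss = map length p"
  shows "order_iso p (map (map f) iss) \<longleftrightarrow> (\<forall>s < length (letters p). \<forall>t < length (letters p).
     f (concat iss ! s) > f (concat iss ! t) \<longleftrightarrow> letters p ! s > letters p ! t)"
proof -
  have l: "length (concat iss) = length (concat p)"
    using assms by (simp add: length_concat)
  have "map length (map (map f) iss) = map length p"
    using assms by (simp add: comp_def)
  moreover have "set (zip (concat p) (concat (map (map f) iss))) =
     (\<lambda>s. (letters p ! s, f (concat iss ! s))) ` {..<length (letters p)}"
    unfolding map_concat[symmetric] letters_def set_zip using l by auto
  ultimately show ?thesis
    unfolding order_iso_def by auto
qed

lemma image_Collect_comp: "f ` {x \<in> X. P (f x)} = {y \<in> f ` X. P y}"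
  by blast

text \<open>With the block lengths prescribed by \<open>p\<close>, a flat position list can be cut
  into blocks in only one way, so \<open>concat\<close> is a bijection between the two kinds of
  occurrences.\<close>

lemma card_occurrences:
  assumes "[] \<notin> set p"
  shows "card (occurrences p w) =
    card {iss \<in> placements (map length p) (length w). order_iso p (map (map ((!) w)) iss)}"
proof -
  let ?S = "{iss \<in> placements (map length p) (length w). order_iso p (map (map ((!) w)) iss)}"
  have "inj_on concat ?S"
  proof (rule inj_onI)
    fix a b assume ab: "a \<in> ?S" "b \<in> ?S" "concat a = concat b"
    then have m: "map length a = map length b" by (simp add: placements_def)
    then have "length a = length b" by (rule map_eq_imp_length_eq)
    moreover have "\<forall>(x, y) \<in> set (zip a b). length x = length y"
    proof -
      have "length (a ! i) = length (b ! i)" if "i < length a" "i < length b" for i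
        using arg_cong[OF m, of "\<lambda>xs. xs ! i"] that by simp
      then show ?thesis by (auto simp: set_zip)
    qed
    ultimately show "a = b" using ab(3) by (intro concat_injective) auto
  qed
  moreover have "concat ` ?S = occurrences p w"
  proof -
    let ?R = "\<lambda>is. \<forall>s < length (letters p). \<forall>t < length (letters p).
             w ! (is ! s) > w ! (is ! t) \<longleftrightarrow> letters p ! s > letters p ! t"
    have occ: "occurrences p w = {is \<in> {is. length is = length (letters p) \<and>
       (\<forall>s. Suc s < length (letters p) \<and> Suc s \<notin> dashes p \<longrightarrow> is ! Suc s = Suc (is ! s))}.
         sorted_wrt (<) is \<and> set is \<subseteq> {..<length w} \<and>
          ?R is}"
      unfolding occurrences_def by blast
    have S: "?S = {iss \<in> {iss. map length iss = map length p \<and> (\<forall>b \<in> set iss. \<exists>s. b = [s..<s + length b])}.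
       sorted_wrt (<) (concat iss) \<and> set (concat iss) \<subseteq> {..<length w} \<and> ?R (concat iss)}"
    proof (rule set_eqI)
      fix iss
      show "iss \<in> ?S \<longleftrightarrow> iss \<in> {iss \<in> {iss. map length iss = map length p \<and>
          (\<forall>b \<in> set iss. \<exists>s. b = [s..<s + length b])}.
          sorted_wrt (<) (concat iss) \<and> set (concat iss) \<subseteq> {..<length w} \<and> ?R (concat iss)}"
      proof (cases "map length iss = map length p")
        case True
        show ?thesis
          unfolding placements_def mem_Collect_eq order_iso_iff_nth[OF True] by (simp only: conj_assoc)
      next
        case False
        then show ?thesis
          unfolding placements_def mem_Collect_eq by (simp only: simp_thms)
      qed
    qed
    show ?thesis
      unfolding occ dashed_positions_eq_concat_image[OF assms] S by (rule image_Collect_comp)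
  qed
  ultimately show ?thesis using card_image by fastforce
qed

section \<open>Matches in flagged words and transversals of block lists\<close>

text \<open>The flag of a letter tells whether a dash-free block of the pattern may use that letter
  together with the next one.\<close>

definition linked :: "nat \<Rightarrow> ('a \<times> bool) list \<Rightarrow> bool" where
  "linked m z \<longleftrightarrow> m \<le> length z \<and> (\<forall>i. Suc i < m \<longrightarrow> snd (z ! i))"

text \<open>A scan from the left: either no block uses the first letter, or the first block starts
  there. The values chosen so far are stored inside the predicate \<open>Q\<close>, which is only
  evaluated once all blocks are placed.\<close>

fun count_matches :: "('a list list \<Rightarrow> bool) \<Rightarrow> nat list \<Rightarrow> ('a \<times> bool) list \<Rightarrow> nat" where
  "count_matches Q [] z = of_bool (Q [])"
| "count_matches Q (m # ms) [] = 0"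
| "count_matches Q (m # ms) (a # z) = count_matches Q (m # ms) z +
     (if linked m (a # z)
      then count_matches (\<lambda>vs. Q (map fst (take m (a # z)) # vs)) ms (drop m (a # z)) else 0)"

fun factors :: "nat \<Rightarrow> ('a \<times> bool) list \<Rightarrow> 'a list list" where
  "factors m [] = []"
| "factors m (a # z) = (if linked m (a # z) then [map fst (take m (a # z))] else []) @ factors m z"

text \<open>Each entry of \<open>Bs\<close> contributes at most one pattern block. This is the count
  that does not distinguish the left end of \<open>Bs\<close> from the right end.\<close>

fun count_transversals ::
    "('a list list \<Rightarrow> bool) \<Rightarrow> nat list \<Rightarrow> ('a \<times> bool) list list \<Rightarrow> nat" where
  "count_transversals Q [] Bs = of_bool (Q [])"
| "count_transversals Q (m # ms) [] = 0"
| "count_transversals Q (m # ms) (B # Bs) = count_transversals Q (m # ms) Bs +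
     (\<Sum>v\<leftarrow>factors m B. count_transversals (\<lambda>vs. Q (v # vs)) ms Bs)"

lemma sum_list_commute:
  fixes f :: "'a \<Rightarrow> 'b \<Rightarrow> nat"
  shows "(\<Sum>x\<leftarrow>xs. \<Sum>y\<leftarrow>ys. f x y) = (\<Sum>y\<leftarrow>ys. \<Sum>x\<leftarrow>xs. f x y)"
  by (induction xs) (simp_all add: sum_list_addf)

text \<open>The defining recursion, but from the right end. The terms that take one block from each
  end agree after exchanging two finite sums.\<close>

lemma count_transversals_snoc:
  "count_transversals Q (ms @ [m]) (Bs @ [B]) = count_transversals Q (ms @ [m]) Bs +
     (\<Sum>v\<leftarrow>factors m B. count_transversals (\<lambda>vs. Q (vs @ [v])) ms Bs)"
proof (induction Bs arbitrary: Q ms)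
  case Nil
  show ?case
  proof (cases ms)
    case (Cons a list)
    then show ?thesis by (cases list) simp_all
  qed simp
next
  case (Cons A Bs)
  show ?case
  proof (cases ms)
    case Nil
    then show ?thesis using Cons[of Q "[]"] by simp
  next
    case (Cons k ms')
    then show ?thesis using Cons.IH[of Q ms] Cons.IH[of _ ms']
      by (simp add: sum_list_addf sum_list_commute[of _ "factors m B"])
  qed
qed

text \<open>Under reversal, the recursion at the left end of \<open>Bs\<close> turns into
  \<open>count_transversals_snoc\<close>.\<close>

lemma count_transversals_rev:
  "count_transversals (\<lambda>vs. Q (rev vs)) (rev ms) (rev Bs) = count_transversals Q ms Bs"
proof (induction Q ms Bs rule: count_transversals.induct)
  case (2 Q m ms)
  then show ?case by (cases "rev ms") simp_all
next
  case (3 Q m ms B Bs)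
  then show ?case by (simp add: count_transversals_snoc cong: map_cong)
qed simp

text \<open>Clearing the flag of the last letter keeps matches from straddling two blocks.\<close>

definition increasing_block :: "('a::linorder \<times> bool) list \<Rightarrow> bool" where
  "increasing_block B \<longleftrightarrow> B \<noteq> [] \<and> sorted_wrt (<) (map fst B) \<and> \<not> snd (last B)"

lemma count_matches_False: "(\<And>vs. \<not> Q vs) \<Longrightarrow> count_matches Q ms z = 0"
  by (induction Q ms z rule: count_matches.induct) auto

text \<open>A window reaching beyond \<open>D\<close> would contain the last letter of
  \<open>D\<close> before its own end and hence need the flag that is cleared.\<close>

lemma linked_append:
  assumes "D \<noteq> []" "\<not> snd (last D)"
  shows "linked m (D @ z) \<longleftrightarrow> linked m D"
proof
  assume L: "linked m (D @ z)"
  have "m \<le> length D"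
  proof (rule ccontr)
    assume "\<not> m \<le> length D"
    then have "snd ((D @ z) ! (length D - 1))"
      using L assms(1) by (auto simp: linked_def)
    then show False using assms by (simp add: nth_append last_conv_nth)
  qed
  then show "linked m D" using L by (auto simp: linked_def nth_append)
qed (auto simp: linked_def nth_append)

text \<open>For increasing lists this says that the ranges of values meet. The first half keeps
  \<open>v\<close> from following \<open>u\<close> within one increasing run; the second half makes
  the relation symmetric, so that it survives reversal of the pattern.\<close>

definition overlapping :: "'a::linorder list \<Rightarrow> 'a list \<Rightarrow> bool" where
  "overlapping u v \<longleftrightarrow> hd v \<le> last u \<and> hd u \<le> last v"

text \<open>Used for the rest of an increasing block from which a pattern block has already been
  taken: whatever starts in it is rejected by \<open>Q\<close>.\<close>

lemma count_matches_skip: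
  assumes "m > 0" "D \<noteq> [] \<Longrightarrow> \<not> snd (last D)"
    and "\<And>v vs. v \<noteq> [] \<Longrightarrow> hd v \<in> fst ` set D \<Longrightarrow> \<not> Q (v # vs)"
  shows "count_matches Q (m # ms) (D @ z) = count_matches Q (m # ms) z"
  using assms(2,3)
proof (induction D)
  case (Cons a D)
  have "count_matches (\<lambda>vs. Q (map fst (take m (a # D @ z)) # vs)) ms (drop m (a # D @ z)) = 0"
    using assms(1) Cons.prems by (intro count_matches_False) (simp add: take_Cons')
  moreover have "count_matches Q (m # ms) (D @ z) = count_matches Q (m # ms) z"
    using Cons.prems by (intro Cons.IH) (auto split: if_splits)
  ultimately show ?case by simp
qed simp

text \<open>A first pattern block that starts in \<open>B\<close> also ends there, by
  \<open>linked_append\<close>. What remains of \<open>B\<close> has values above the end of that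
  pattern block, so an overlapping second block cannot start there and the match continues in
  \<open>z\<close>.\<close>

lemma count_matches_suffix_append:
  assumes pos: "m > 0" "\<forall>k \<in> set ms. k > 0"
    and B: "sorted_wrt (<) (map fst B)" "B \<noteq> [] \<Longrightarrow> \<not> snd (last B)"
    and Q: "\<And>vs. Q vs \<Longrightarrow> successively overlapping vs"
  shows "count_matches Q (m # ms) (B @ z) = count_matches Q (m # ms) z +
     (\<Sum>v\<leftarrow>factors m B. count_matches (\<lambda>vs. Q (v # vs)) ms z)"
  using B
proof (induction B)
  case (Cons a B)
  let ?B = "a # B" and ?v = "map fst (take m (a # B))"
  have IH: "count_matches Q (m # ms) (B @ z) = count_matches Q (m # ms) z +
     (\<Sum>v\<leftarrow>factors m B. count_matches (\<lambda>vs. Q (v # vs)) ms z)"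
    using Cons.prems by (intro Cons.IH) (auto split: if_splits)
  have L: "linked m (?B @ z) \<longleftrightarrow> linked m ?B"
    using Cons.prems by (intro linked_append) auto
  have "count_matches (\<lambda>vs. Q (?v # vs)) ms (drop m ?B @ z) = count_matches (\<lambda>vs. Q (?v # vs)) ms z"
    if m: "m \<le> length ?B"
  proof (cases ms)
    case (Cons k ms')
    show ?thesis unfolding Cons
    proof (rule count_matches_skip)
      show "k > 0" using pos Cons by simp
      show "\<not> snd (last (drop m ?B))" if "drop m ?B \<noteq> []"
        using that Cons.prems(2) by (metis last_drop drop_eq_Nil not_le list.discI)
      fix v vs assume v: "hd v \<in> fst ` set (drop m ?B)"
      have "sorted_wrt (<) (?v @ map fst (drop m ?B))"
        using Cons.prems(1) by (metis append_take_drop_id map_append)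
      moreover have "?v \<noteq> []" using pos by simp
      moreover have "hd v \<in> set (map fst (drop m ?B))" using v by simp
      ultimately have "last ?v < hd v"
        unfolding sorted_wrt_append by (meson last_in_set)
      then show "\<not> Q (?v # v # vs)"
        using Q[of "?v # v # vs"] by (auto simp: overlapping_def)
    qed
  qed simp
  moreover have "linked m ?B \<Longrightarrow> m \<le> length ?B" by (simp add: linked_def)
  ultimately have "(if linked m ?B
     then count_matches (\<lambda>vs. Q (map fst (take m (?B @ z)) # vs)) ms (drop m (?B @ z)) else 0) =
     (if linked m ?B then count_matches (\<lambda>vs. Q (?v # vs)) ms z else 0)"
    by (simp del: append_Cons)
  then show ?case using L IH by (cases "linked m ?B") simp_all
qed simp

text \<open>Iterates \<open>count_matches_suffix_append\<close> over the entries of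
  \<open>Bs\<close>. This turns matches in a flagged word, where left and right differ, into the
  reversible count of transversals.\<close>

lemma count_matches_concat:
  assumes "\<forall>k \<in> set ms. k > 0" "\<forall>B \<in> set Bs. increasing_block B"
    and "\<And>vs. Q vs \<Longrightarrow> successively overlapping vs"
  shows "count_matches Q ms (concat Bs) = count_transversals Q ms Bs"
  using assms
proof (induction Q ms Bs rule: count_transversals.induct)
  case (3 Q m ms B Bs)
  have "count_matches (\<lambda>vs. Q (v # vs)) ms (concat Bs) = count_transversals (\<lambda>vs. Q (v # vs)) ms Bs"
    if "v \<in> set (factors m B)" for v
  proof (rule 3(2)[OF that])
    show "successively overlapping vs" if "Q (v # vs)" for vs
      using 3(5)[OF that] by (cases vs) auto
  qed (use 3(3,4) in auto)
  moreover have "count_matches Q (m # ms) (concat Bs) = count_transversals Q (m # ms) Bs"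
    using 3 by simp
  moreover have "count_matches Q (m # ms) (B @ concat Bs) = count_matches Q (m # ms) (concat Bs) +
     (\<Sum>v\<leftarrow>factors m B. count_matches (\<lambda>vs. Q (v # vs)) ms (concat Bs))"
    using 3(3,4,5) by (intro count_matches_suffix_append) (auto simp: increasing_block_def)
  ultimately show ?case by (simp cong: map_cong)
qed simp_all

section \<open>Signed sums over decompositions into increasing blocks\<close>

fun mark_ascents :: "'a::linorder list \<Rightarrow> ('a \<times> bool) list" where
  "mark_ascents [] = []"
| "mark_ascents [x] = [(x, False)]"
| "mark_ascents (x # y # w) = (x, x < y) # mark_ascents (y # w)"

lemma map_fst_mark_ascents [simp]: "map fst (mark_ascents w) = w"
  by (induction w rule: mark_ascents.induct) auto

text \<open>Flags inside a block may be cleared as well. Hence a cut is forced at a non-ascent,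
  forbidden behind a letter whose flag is set, and optional at an ascent whose flag is
  cleared.\<close>

definition block_decompositions :: "('a::linorder \<times> bool) list \<Rightarrow> ('a \<times> bool) list list set" where
  "block_decompositions z = {Bs. concat Bs = z \<and> (\<forall>B \<in> set Bs. increasing_block B)}"

lemma block_decompositions_Nil: "block_decompositions [] = {[]}"
  by (auto simp: block_decompositions_def increasing_block_def)

text \<open>The new letter either is a block by itself, which needs a cleared flag, or is glued to
  the first block of the rest, which needs an ascent.\<close>

lemma block_decompositions_Cons:
  "block_decompositions (a # z) =
     (if snd a then {} else (#) [a] ` block_decompositions z) \<union>
     (if z \<noteq> [] \<and> fst a < fst (hd z)
      then (\<lambda>Bs. (a # hd Bs) # tl Bs) ` block_decompositions z else {})"
proof (intro equalityI subsetI)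
  fix Bs assume Bs: "Bs \<in> block_decompositions (a # z)"
  then obtain C Cs where Cs: "Bs = C # Cs"
    by (cases Bs) (auto simp: block_decompositions_def)
  then have C: "increasing_block C" "C @ concat Cs = a # z" "\<forall>B \<in> set Cs. increasing_block B"
    using Bs by (auto simp: block_decompositions_def)
  then obtain D where D: "C = a # D" "z = D @ concat Cs"
    by (cases C) (auto simp: increasing_block_def)
  show "Bs \<in> (if snd a then {} else (#) [a] ` block_decompositions z) \<union>
     (if z \<noteq> [] \<and> fst a < fst (hd z)
      then (\<lambda>Bs. (a # hd Bs) # tl Bs) ` block_decompositions z else {})"
  proof (cases "D = []")
    case True
    then show ?thesis using Cs C D by (auto simp: block_decompositions_def increasing_block_def)
  next
    case False
    then have "increasing_block D" "fst a < fst (hd z)"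
      using C D by (auto simp: increasing_block_def)
    then have "D # Cs \<in> block_decompositions z" "z \<noteq> []"
      using C D False by (auto simp: block_decompositions_def)
    then show ?thesis using Cs D \<open>fst a < fst (hd z)\<close> by (auto intro!: image_eqI[of _ _ "D # Cs"])
  qed
next
  fix Bs assume "Bs \<in> (if snd a then {} else (#) [a] ` block_decompositions z) \<union>
     (if z \<noteq> [] \<and> fst a < fst (hd z)
      then (\<lambda>Bs. (a # hd Bs) # tl Bs) ` block_decompositions z else {})"
  then consider Cs where "\<not> snd a" "Bs = [a] # Cs" "Cs \<in> block_decompositions z"
    | Cs where "z \<noteq> []" "fst a < fst (hd z)" "Bs = (a # hd Cs) # tl Cs" "Cs \<in> block_decompositions z"
    by (auto split: if_splits)
  then show "Bs \<in> block_decompositions (a # z)"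
  proof cases
    case 1
    then show ?thesis by (auto simp: block_decompositions_def increasing_block_def)
  next
    case 2
    then obtain D Ds where "Cs = D # Ds"
      by (cases Cs) (auto simp: block_decompositions_def)
    moreover from this obtain d D' where "D = d # D'"
      using 2 by (cases D) (auto simp: block_decompositions_def increasing_block_def)
    ultimately show ?thesis using 2
      by (auto simp: block_decompositions_def increasing_block_def)
  qed
qed

abbreviation unlinks :: "('a \<times> bool) list \<Rightarrow> nat" where
  "unlinks z \<equiv> length (filter (\<lambda>a. \<not> snd a) z)"

text \<open>Wherever an ascent is not linked, splitting or merging the blocks there changes the sign, so
  only the words all of whose ascents are linked survive.\<close>

lemma sum_block_decompositions:
  "finite (block_decompositions z) \<and>
   (\<Sum>Bs \<in> block_decompositions z. (- 1) ^ length Bs) =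
     (if z = mark_ascents (map fst z) then (- 1 :: int) ^ unlinks z else 0)"
proof (induction z)
  case Nil
  then show ?case by (simp add: block_decompositions_Nil)
next
  case (Cons a z)
  let ?D = "block_decompositions z" and ?E = "block_decompositions (a # z)"
  let ?glue = "\<lambda>Bs. (a # hd Bs) # tl Bs" and ?s = "\<Sum>Bs \<in> ?D. (- 1 :: int) ^ length Bs"
  have fin: "finite ?D" using Cons by simp
  have alone: "(\<Sum>Bs \<in> (#) [a] ` ?D. (- 1 :: int) ^ length Bs) = - ?s"
    by (subst sum.reindex) (auto simp: sum_negf)
  have ne: "Bs \<noteq> []" "hd Bs \<noteq> []" if "z \<noteq> []" "Bs \<in> ?D" for Bs
    using that by (cases Bs; auto simp: block_decompositions_def increasing_block_def)+
  have glue: "(\<Sum>Bs \<in> ?glue ` ?D. (- 1 :: int) ^ length Bs) = ?s" if "z \<noteq> []"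
  proof (subst sum.reindex)
    show "inj_on ?glue ?D"
      using ne[OF that] by (intro inj_onI) (metis list.expand list.inject)
  next
    show "sum ((\<lambda>Bs. (- 1 :: int) ^ length Bs) \<circ> ?glue) ?D = ?s"
      using ne(1)[OF that] by (intro sum.cong) (auto simp: neq_Nil_conv)
  qed
  have disj: "(#) [a] ` ?D \<inter> ?glue ` ?D = {}" if "z \<noteq> []"
    using ne(2)[OF that] by (auto dest!: sym[of "[]"])
  \<comment> \<open>A cleared flag at an ascent makes the two terms cancel, a set flag at a
    non-ascent leaves no term. In the two consistent cases the sign changes exactly when the new
    flag is cleared, in step with \<open>unlinks\<close>.\<close>
  have sum: "(\<Sum>Bs \<in> ?E. (- 1 :: int) ^ length Bs) =
     (if snd a then 0 else - ?s) + (if z \<noteq> [] \<and> fst a < fst (hd z) then ?s else 0)"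
    unfolding block_decompositions_Cons
    using fin alone glue disj by (auto simp: sum.union_disjoint)
  have "a # z = mark_ascents (map fst (a # z)) \<longleftrightarrow>
     snd a = (z \<noteq> [] \<and> fst a < fst (hd z)) \<and> z = mark_ascents (map fst z)"
    by (cases a; cases z) auto
  then show ?case
    using Cons sum fin by (auto simp: block_decompositions_Cons simp del: mark_ascents.simps)
qed

section \<open>Occurrences in a word as matches in its flagged version\<close>

lemma placements_shift:
  "{iss \<in> placements ms (k + n). \<forall>i \<in> set (concat iss). k \<le> i} = map (map ((+) k)) ` placements ms n"
proof (intro equalityI subsetI)
  fix iss assume iss: "iss \<in> {iss \<in> placements ms (k + n). \<forall>i \<in> set (concat iss). k \<le> i}"
  \<comment> \<open>All positions are at least \<open>k\<close>, so the subtraction is never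
    truncated and preserves the strict order.\<close>
  let ?jss = "map (map (\<lambda>i. i - k)) iss"
  have ge: "k \<le> i" if "b \<in> set iss" "i \<in> set b" for b i
    using iss that by auto
  have "map ((+) k) (map (\<lambda>i. i - k) b) = b" if "b \<in> set iss" for b
    unfolding map_map by (rule map_idI) (use ge[OF that] in simp)
  then have "map (\<lambda>b. map ((+) k) (map (\<lambda>i. i - k) b)) iss = iss"
    by (rule map_idI)
  then have "iss = map (map ((+) k)) ?jss" by (simp add: comp_def)
  moreover have "?jss \<in> placements ms n"
  proof -
    have "\<exists>s. map (\<lambda>i. i - k) b = [s..<s + length b]" if b: "b \<in> set iss" for b
    proof -
      obtain s where s: "b = [s..<s + length b]"
        using iss b by (auto simp: placements_def)
      show ?thesis
      proof (cases "b = []")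
        case False
        then have "s \<in> set b" using s by (metis hd_in_set hd_upt length_greater_0_conv less_add_same_cancel1)
        then have "k \<le> s" using ge b by blast
        then have "map (\<lambda>i. i - k) [s..<s + length b] = [s - k..<s - k + length b]"
          by (intro nth_equalityI) auto
        then show ?thesis using s by metis
      qed simp
    qed
    moreover have "sorted_wrt (<) (map (\<lambda>i. i - k) (concat iss))"
    proof (rule sorted_wrt_map_mono)
      show "sorted_wrt (<) (concat iss)" using iss by (simp add: placements_def)
      show "i - k < j - k" if "i \<in> set (concat iss)" "j \<in> set (concat iss)" "i < j" for i j
        using iss that by (intro diff_less_mono) auto
    qed
    moreover have "set (map (\<lambda>i. i - k) (concat iss)) \<subseteq> {..<n}"
      using iss by (force simp: placements_def)
    ultimately show ?thesis
      using iss unfolding placements_def map_concat by (simp add: comp_def)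
  qed
  ultimately show "iss \<in> map (map ((+) k)) ` placements ms n" by (rule image_eqI)
next
  fix iss assume "iss \<in> map (map ((+) k)) ` placements ms n"
  then obtain jss where jss: "iss = map (map ((+) k)) jss" "jss \<in> placements ms n" by blast
  have "\<exists>s. map ((+) k) b = [s..<s + length b]" if b: "b \<in> set jss" for b
  proof -
    obtain s where "b = [s..<s + length b]" using jss b by (auto simp: placements_def)
    moreover have "map ((+) k) [s..<s + length b] = [k + s..<k + s + length b]"
      by (intro nth_equalityI) auto
    ultimately show ?thesis by metis
  qed
  moreover have "sorted_wrt (<) (map ((+) k) (concat jss))" "\<forall>i \<in> set (map ((+) k) (concat jss)). k \<le> i"
      "set (map ((+) k) (concat jss)) \<subseteq> {..<k + n}"
    using jss(2) by (auto simp: placements_def sorted_wrt_map)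
  ultimately show "iss \<in> {iss \<in> placements ms (k + n). \<forall>i \<in> set (concat iss). k \<le> i}"
    using jss(2) unfolding jss(1) placements_def map_concat by (simp add: comp_def)
qed

text \<open>The recursion of \<open>count_matches\<close> on the level of positions: either position
  0 stays free, or, positions being increasing, the first block is \<open>[0..<m]\<close>.\<close>

lemma placements_Cons:
  assumes "m > 0"
  shows "placements (m # ms) (Suc n) = map (map Suc) ` placements (m # ms) n \<union>
    (if m \<le> Suc n
     then (\<lambda>iss. [0..<m] # map (map ((+) m)) iss) ` placements ms (Suc n - m) else {})"
    (is "?P = ?A \<union> ?B")
proof -
  have A: "?A = {iss \<in> ?P. \<forall>i \<in> set (concat iss). 1 \<le> i}"
    using placements_shift[of "m # ms" 1 n, unfolded plus_1_eq_Suc] by simp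
  have B: "?B = {iss \<in> ?P. hd (hd iss) = 0}"
  proof (intro equalityI subsetI)
    fix iss assume "iss \<in> ?B"
    then have m: "m \<le> Suc n"
      and "iss \<in> (\<lambda>iss. [0..<m] # iss) ` map (map ((+) m)) ` placements ms (Suc n - m)"
      by (auto split: if_splits)
    then obtain jss where jss: "iss = [0..<m] # jss" "jss \<in> placements ms (Suc n)"
        "\<forall>i \<in> set (concat jss). m \<le> i"
      using placements_shift[of ms m "Suc n - m"] by auto
    then have "sorted_wrt (<) (concat ([0..<m] # jss))"
      by (fastforce simp: placements_def sorted_wrt_append)
    moreover have "set (concat ([0..<m] # jss)) \<subseteq> {..<Suc n}"
      using m jss(2) by (auto simp: placements_def)
    moreover have "hd [0..<m] = 0" using assms by simp
    moreover have "\<exists>s. [0..<m] = [s..<s + m]" by (metis add_0)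
    ultimately show "iss \<in> {iss \<in> ?P. hd (hd iss) = 0}"
      using jss(2) unfolding jss(1) placements_def by (simp del: concat.simps)
  next
    fix iss assume iss: "iss \<in> {iss \<in> ?P. hd (hd iss) = 0}"
    then obtain b jss where b: "iss = b # jss" by (cases iss) (auto simp: placements_def)
    then have P: "length b = m" "\<exists>s. b = [s..<s + m]" "hd b = 0" "sorted_wrt (<) (b @ concat jss)"
        "set b \<subseteq> {..<Suc n}" "jss \<in> placements ms (Suc n)"
      using iss by (auto simp: placements_def sorted_wrt_append)
    moreover from P(2) obtain s where s: "b = [s..<s + m]" by blast
    ultimately have b0: "b = [0..<m]" using assms by simp
    then have m: "m \<le> Suc n" using P(5) assms by (cases m) auto
    have "m - 1 \<in> set b" using b0 assms by simp
    then have "\<forall>i \<in> set (concat jss). m - 1 < i"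
      using P(4) unfolding sorted_wrt_append by blast
    then have "\<forall>i \<in> set (concat jss). m \<le> i" by fastforce
    then have "jss \<in> map (map ((+) m)) ` placements ms (Suc n - m)"
      using P(6) m placements_shift[of ms m "Suc n - m"] by auto
    then show "iss \<in> ?B" using m b b0 by auto
  qed
  have "hd (hd iss) = 0 \<or> (\<forall>i \<in> set (concat iss). 1 \<le> i)" if iss: "iss \<in> ?P" for iss
  proof -
    obtain b jss where b: "iss = b # jss" "length b = m" "sorted_wrt (<) (b @ concat jss)"
      using iss by (cases iss) (auto simp: placements_def)
    then obtain c b' where "b = c # b'" using assms by (cases b) auto
    then show ?thesis using b by (cases c) (auto dest!: bspec)
  qed
  then show ?thesis unfolding A B by blast
qed

lemma finite_placements: "finite (placements ms n)"
proof (rule finite_subset)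
  let ?X = "{xs. set xs \<subseteq> {..<n} \<and> length xs \<le> sum_list ms}"
  show "placements ms n \<subseteq> {iss. set iss \<subseteq> ?X \<and> length iss = length ms}"
    by (auto simp: placements_def intro!: member_le_sum_list)
  show "finite {iss. set iss \<subseteq> ?X \<and> length iss = length ms}"
    by (intro finite_lists_length_eq finite_lists_length_le) simp
qed

lemma length_mark_ascents [simp]: "length (mark_ascents w) = length w"
  by (induction w rule: mark_ascents.induct) auto

lemma snd_mark_ascents_nth:
  "Suc i < length w \<Longrightarrow> snd (mark_ascents w ! i) \<longleftrightarrow> w ! i < w ! Suc i"
proof (induction w arbitrary: i rule: mark_ascents.induct)
  case (3 x y w)
  then show ?case by (cases i) simp_all
qed simp_all

lemma drop_mark_ascents: "drop m (mark_ascents w) = mark_ascents (drop m w)"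
proof (induction w arbitrary: m rule: mark_ascents.induct)
  case (2 x)
  then show ?case by (cases m) simp_all
next
  case (3 x y w)
  then show ?case by (cases m) simp_all
qed simp

lemma linked_mark_ascents:
  assumes "m \<le> length w" "sorted_wrt (<) (take m w)"
  shows "linked m (mark_ascents w)"
  unfolding linked_def
proof (intro conjI allI impI)
  fix i assume i: "Suc i < m"
  then have "take m w ! i < take m w ! Suc i"
    using assms by (intro sorted_wrt_nth_less[of "(<)" "take m w"]) auto
  then show "snd (mark_ascents w ! i)"
    using i assms(1) by (simp add: snd_mark_ascents_nth)
qed (use assms(1) in simp)

text \<open>Both sides obey the same recursion. The test \<open>linked\<close> loses nothing because
  \<open>Q\<close> accepts increasing blocks only. The induction is on the length, since placing a
  block removes \<open>m\<close> letters at once.\<close>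

lemma card_placements_eq_count_matches:
  assumes "\<forall>k \<in> set ms. k > 0" "\<And>vs v. Q vs \<Longrightarrow> v \<in> set vs \<Longrightarrow> sorted_wrt (<) v"
  shows "card {iss \<in> placements ms (length w). Q (map (map ((!) w)) iss)} =
    count_matches Q ms (mark_ascents w)"
  using assms
proof (induction w arbitrary: Q ms rule: length_induct)
  case (1 w)
  show ?case
  proof (cases ms)
    case Nil
    have "{iss \<in> placements [] (length w). Q (map (map ((!) w)) iss)} = (if Q [] then {[]} else {})"
      by (auto simp: placements_def)
    then show ?thesis by (simp add: Nil)
  next
    case ms: (Cons m ms')
    have m: "m > 0" using 1(2) ms by simp
    show ?thesis
    proof (cases w)
      case Nil
      have "placements (m # ms') 0 = {}" using m by (auto simp: placements_def)
      then show ?thesis by (simp add: Nil ms)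
    next
      case w: (Cons x w')
      let ?n = "length w'"
      let ?A = "{iss \<in> map (map Suc) ` placements ms ?n. Q (map (map ((!) w)) iss)}"
      let ?S = "if m \<le> Suc ?n
        then (\<lambda>iss. [0..<m] # map (map ((+) m)) iss) ` placements ms' (Suc ?n - m) else {}"
      let ?B = "{iss \<in> ?S. Q (map (map ((!) w)) iss)}"
      have "placements ms (length w) = map (map Suc) ` placements ms ?n \<union> ?S"
        using placements_Cons[OF m, of ms' ?n] by (simp only: ms w length_Cons)
      then have "{iss \<in> placements ms (length w). Q (map (map ((!) w)) iss)} = ?A \<union> ?B"
        by blast
      moreover have "finite ?A" "finite ?B" by (auto simp: finite_placements)
      moreover have "?A \<inter> ?B = {}"
      proof -
        have "hd (hd iss) \<noteq> 0" if "iss \<in> map (map Suc) ` placements ms ?n" for iss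
          using that m by (auto simp: placements_def ms hd_map map_eq_Cons_conv)
        moreover have "hd (hd iss) = 0" if "iss \<in> ?S" for iss
          using that m by (auto split: if_splits)
        ultimately show ?thesis by blast
      qed
      ultimately have card: "card {iss \<in> placements ms (length w). Q (map (map ((!) w)) iss)} =
          card ?A + card ?B"
        by (simp add: card_Un_disjoint)
      have shift_Suc: "map (map ((!) w)) (map (map Suc) iss) = map (map ((!) w')) iss" for iss
        by (simp add: w comp_def)
      have "?A = map (map Suc) ` {iss \<in> placements ms ?n. Q (map (map ((!) w')) iss)}"
        unfolding shift_Suc[symmetric] by (rule image_Collect_comp[symmetric])
      then have "card ?A = card {iss \<in> placements ms ?n. Q (map (map ((!) w')) iss)}"
        by (simp add: card_image inj_on_def inj_map_eq_map)
      also have "\<dots> = count_matches Q ms (mark_ascents w')"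
        using 1 w by simp
      finally have A: "card ?A = count_matches Q ms (mark_ascents w')" .
      let ?Q = "\<lambda>vs. Q (take m w # vs)"
      have B: "card ?B = (if linked m (mark_ascents w)
        then count_matches ?Q ms' (mark_ascents (drop m w)) else 0)"
      proof (cases "m \<le> length w")
        case True
        have "map ((!) w) [0..<m] = take m w"
          using True by (intro nth_equalityI) auto
        then have shift: "map (map ((!) w)) ([0..<m] # map (map ((+) m)) iss) =
            take m w # map (map ((!) (drop m w))) iss" for iss
          using True by (simp add: comp_def)
        have "?B = {iss \<in> (\<lambda>iss. [0..<m] # map (map ((+) m)) iss) ` placements ms' (Suc ?n - m).
            Q (map (map ((!) w)) iss)}"
          using True w by simp
        also have "\<dots> = (\<lambda>iss. [0..<m] # map (map ((+) m)) iss) `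
            {iss \<in> placements ms' (Suc ?n - m). ?Q (map (map ((!) (drop m w))) iss)}"
          unfolding shift[symmetric] by (rule image_Collect_comp[symmetric])
        finally have "?B = (\<lambda>iss. [0..<m] # map (map ((+) m)) iss) `
            {iss \<in> placements ms' (Suc ?n - m). ?Q (map (map ((!) (drop m w))) iss)}" .
        moreover have "inj (\<lambda>iss. [0..<m] # map (map ((+) m)) iss)"
          by (auto simp: inj_def inj_map_eq_map)
        ultimately have *: "card ?B = card {iss \<in> placements ms' (length (drop m w)).
            ?Q (map (map ((!) (drop m w))) iss)}"
          using w by (simp add: card_image inj_on_subset)
        show ?thesis
        proof (cases "linked m (mark_ascents w)")
          case linked: True
          have "length (drop m w) < length w" using m w by simp
          then have "card {iss \<in> placements ms' (length (drop m w)). ?Q (map (map ((!) (drop m w))) iss)} =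
              count_matches ?Q ms' (mark_ascents (drop m w))"
          proof (intro 1(1)[rule_format])
            show "sorted_wrt (<) v" if "?Q vs" "v \<in> set vs" for vs v
              using 1(3)[OF that(1)] that(2) by simp
          qed (use 1(2) ms in auto)
          then show ?thesis using * linked by simp
        next
          case False
          \<comment> \<open>A full window that is not linked contains a non-ascent, so
            \<open>Q\<close> rejects every placement that starts with it.\<close>
          then have "\<not> sorted_wrt (<) (take m w)" using True linked_mark_ascents by blast
          then have "\<not> ?Q vs" for vs using 1(3)[of "take m w # vs"] by auto
          then show ?thesis using * False by simp
        qed
      next
        case False
        then show ?thesis using w by (simp add: linked_def)
      qed
      \<comment> \<open>Only the flag of the first letter depends on its successor; the other flags
        are those of \<open>w'\<close> on its own.\<close>
      obtain f where w_marks: "mark_ascents w = (x, f) # mark_ascents w'"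
        using w by (cases w') auto
      have "count_matches Q ms (mark_ascents w) = count_matches Q ms (mark_ascents w') +
        (if linked m (mark_ascents w)
         then count_matches (\<lambda>vs. Q (map fst (take m (mark_ascents w)) # vs)) ms'
           (drop m (mark_ascents w)) else 0)"
        unfolding ms w_marks by simp
      then show ?thesis
        using card A B by (simp add: drop_mark_ascents flip: take_map)
    qed
  qed
qed

lemma order_iso_sorted:
  assumes "order_iso p vs" "\<forall>b \<in> set p. sorted_wrt (<) b" "v \<in> set vs"
  shows "sorted_wrt (<) v"
proof -
  have len: "map length vs = map length p" using assms(1) by (simp add: order_iso_def)
  then have l: "length vs = length p" by (rule map_eq_imp_length_eq)
  obtain i where i: "i < length p" "v = vs ! i" using assms(3) l by (metis in_set_conv_nth)
  have "length v = length (p ! i)" using arg_cong[OF len, of "\<lambda>xs. xs ! i"] i l by simp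
  then show ?thesis
    using order_iso_less[OF assms(1) i(1) i(1)] assms(2) i
    by (auto simp: sorted_wrt_iff_nth_less)
qed

text \<open>Overlap only compares first and last letters of neighbouring blocks, and an order
  isomorphism preserves such comparisons.\<close>

lemma order_iso_overlapping:
  assumes "order_iso p vs" "[] \<notin> set p" "successively overlapping p"
  shows "successively overlapping vs"
proof -
  have len: "map length vs = map length p" using assms(1) by (simp add: order_iso_def)
  then have l: "length vs = length p" by (rule map_eq_imp_length_eq)
  have li: "length (vs ! i) = length (p ! i)" "p ! i \<noteq> []" if "i < length p" for i
    using arg_cong[OF len, of "\<lambda>xs. xs ! i"] l that assms(2) by (auto simp: in_set_conv_nth)
  have ends: "hd (u ! i) = u ! i ! 0" "last (u ! i) = u ! i ! (length (p ! i) - 1)"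
    if "i < length p" "u = vs \<or> u = p" for u i
    using that li[OF that(1)] by (metis hd_conv_nth length_0_conv, metis last_conv_nth length_0_conv)
  have "last (vs ! i) < hd (vs ! j) \<longleftrightarrow> last (p ! i) < hd (p ! j)"
    if "i < length p" "j < length p" for i j
    using order_iso_less[OF assms(1) that, of "length (p ! i) - 1" 0] li that by (simp add: ends)
  then show ?thesis
    using assms(3) l by (auto simp: successively_conv_nth overlapping_def simp flip: not_less)
qed

lemma card_occurrences_eq_count_matches:
  assumes "[] \<notin> set p" "\<forall>b \<in> set p. sorted_wrt (<) b"
  shows "card (occurrences p w) = count_matches (order_iso p) (map length p) (mark_ascents w)"
  unfolding card_occurrences[OF assms(1)]
proof (rule card_placements_eq_count_matches)
  show "\<forall>k \<in> set (map length p). k > 0" using assms(1) by auto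
qed (use assms(2) order_iso_sorted in blast)

section \<open>Reversing the order of the blocks\<close>

text \<open>The elements are lists of blocks rather than flagged words: one flagged word may come
  from several lists, and the signed sum runs over all of them.\<close>

definition marked_block_lists ::
    "nat \<Rightarrow> nat \<Rightarrow> nat \<Rightarrow> dashed_pattern \<Rightarrow> (nat \<times> bool) list list set" where
  "marked_block_lists l n k p = {Bs. (\<forall>B \<in> set Bs. increasing_block B) \<and>
     fst ` set (concat Bs) \<subseteq> {1..l} \<and> length (concat Bs) = n \<and>
     count_matches (order_iso p) (map length p) (concat Bs) = k}"

text \<open>Group the lists by the flagged word \<open>z\<close> they spell. By
  \<open>sum_block_decompositions\<close> the sum over one group vanishes unless \<open>z\<close>
  carries exactly the ascent flags of its word; the factor with \<open>unlinks\<close> then makes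
  the contribution 1.\<close>

lemma card_words_eq_signed_sum:
  assumes "[] \<notin> set p" "\<forall>b \<in> set p. sorted_wrt (<) b"
  shows "int (card {w \<in> words l. length w = n \<and> card (occurrences p w) = k}) =
    (\<Sum>Bs \<in> marked_block_lists l n k p. (- 1) ^ (unlinks (concat Bs) + length Bs))"
proof -
  let ?c = "count_matches (order_iso p) (map length p)"
  let ?W = "{w \<in> words l. length w = n \<and> card (occurrences p w) = k}"
  let ?Z = "{z. fst ` set z \<subseteq> {1..l} \<and> length z = n \<and> ?c z = k}"
  have finite: "finite ?Z"
  proof (rule finite_subset)
    show "?Z \<subseteq> {z. set z \<subseteq> {1..l} \<times> UNIV \<and> length z = n}" by force
    show "finite {z. set z \<subseteq> {1..l} \<times> (UNIV :: bool set) \<and> length z = n}"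
      by (intro finite_lists_length_eq) simp
  qed
  have UN: "marked_block_lists l n k p = (\<Union>z \<in> ?Z. block_decompositions z)"
    by (auto simp: marked_block_lists_def block_decompositions_def simp del: set_concat)
  have "(\<Sum>Bs \<in> marked_block_lists l n k p. (- 1 :: int) ^ (unlinks (concat Bs) + length Bs)) =
      (\<Sum>z \<in> ?Z. \<Sum>Bs \<in> block_decompositions z. (- 1) ^ (unlinks (concat Bs) + length Bs))"
    unfolding UN using finite sum_block_decompositions
    by (intro sum.UNION_disjoint) (auto simp: block_decompositions_def)
  also have "\<dots> = (\<Sum>z \<in> ?Z. if z = mark_ascents (map fst z) then 1 else 0)"
  proof (rule sum.cong)
    fix z
    have "(\<Sum>Bs \<in> block_decompositions z. (- 1 :: int) ^ (unlinks (concat Bs) + length Bs)) =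
        (\<Sum>Bs \<in> block_decompositions z. (- 1) ^ unlinks z * (- 1) ^ length Bs)"
      by (intro sum.cong) (auto simp: block_decompositions_def power_add)
    also have "\<dots> = (if z = mark_ascents (map fst z) then 1 else 0)"
      using sum_block_decompositions[of z]
      by (simp flip: sum_distrib_left power_mult_distrib)
    finally show "(\<Sum>Bs \<in> block_decompositions z. (- 1 :: int) ^ (unlinks (concat Bs) + length Bs)) =
      (if z = mark_ascents (map fst z) then 1 else 0)" .
  qed simp
  also have "\<dots> = int (card {z \<in> ?Z. z = mark_ascents (map fst z)})"
    using finite by (simp add: sum.If_cases Int_def)
  also have "{z \<in> ?Z. z = mark_ascents (map fst z)} = mark_ascents ` ?W"
  proof -
    have marks: "fst ` set (mark_ascents w) = set w" for w :: "nat list"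
      by (metis list.set_map map_fst_mark_ascents)
    have W: "?W = {w. set w \<subseteq> {1..l} \<and> length w = n \<and> ?c (mark_ascents w) = k}"
      by (simp add: words_def lists_eq_set card_occurrences_eq_count_matches[OF assms])
    show ?thesis
    proof (intro equalityI subsetI)
      fix z assume z: "z \<in> {z \<in> ?Z. z = mark_ascents (map fst z)}"
      then have "?c (mark_ascents (map fst z)) = k" by auto
      then have "map fst z \<in> ?W" using z unfolding W by simp
      then show "z \<in> mark_ascents ` ?W" using z by blast
    next
      fix z assume "z \<in> mark_ascents ` ?W"
      then obtain w where "z = mark_ascents w" "w \<in> ?W" by blast
      then show "z \<in> {z \<in> ?Z. z = mark_ascents (map fst z)}"
        using marks unfolding W by simp
    qed
  qed
  also have "card (mark_ascents ` ?W) = card ?W"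
    by (intro card_image inj_on_inverseI[of _ "map fst"]) simp
  finally show ?thesis by simp
qed

text \<open>Both word counts are signed sums over lists of increasing blocks, where matches are
  transversals, and \<open>rev\<close> matches up the two sums term by term.\<close>

theorem strongly_Wilf_equivalent_rev_blocks:
  assumes ne: "[] \<notin> set p" and sorted: "\<forall>b \<in> set p. sorted_wrt (<) b"
    and overlap: "successively overlapping p"
  shows "strongly_Wilf_equivalent (words l) p (rev p)"
proof -
  have overlap': "successively overlapping (rev p)"
    using overlap by (simp add: overlapping_def conj_commute)
  have count: "count_matches (order_iso q) (map length q) (concat Bs) =
      count_transversals (order_iso q) (map length q) Bs"
    if "\<forall>B \<in> set Bs. increasing_block B" "q = p \<or> q = rev p" for q Bs
    using that ne overlap overlap' order_iso_overlapping
    by (intro count_matches_concat) auto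
  \<comment> \<open>Stated for \<open>p\<close> and \<open>rev p\<close> together, so that
    \<open>rev\<close> is seen to map each of the two sets of lists into the other.\<close>
  have rev_in: "rev Bs \<in> marked_block_lists l n k (rev q)"
    if "Bs \<in> marked_block_lists l n k q" "q = p \<or> q = rev p" for q Bs n k
  proof -
    \<comment> \<open>Reversing the pattern amounts to reversing the argument of the predicate, the
      form in which \<open>count_transversals_rev\<close> applies.\<close>
    have oi: "order_iso (rev q) = (\<lambda>vs. order_iso q (rev vs))"
      using order_iso_rev[of q "rev _"] by auto
    have B: "\<forall>B \<in> set Bs. increasing_block B" using that(1) by (simp add: marked_block_lists_def)
    have "count_matches (order_iso (rev q)) (map length (rev q)) (concat (rev Bs)) =
        count_transversals (order_iso (rev q)) (rev (map length q)) (rev Bs)"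
      using that(2) B by (subst count) (auto simp: rev_map)
    also have "\<dots> = count_matches (order_iso q) (map length q) (concat Bs)"
      unfolding oi count_transversals_rev by (rule count[OF B that(2), symmetric])
    finally have "count_matches (order_iso (rev q)) (map length (rev q)) (concat (rev Bs)) =
        count_matches (order_iso q) (map length q) (concat Bs)" .
    moreover have "length (concat (rev Bs)) = length (concat Bs)"
      by (simp add: length_concat flip: rev_map)
    ultimately show ?thesis
      using that(1) by (simp add: marked_block_lists_def)
  qed
  have "int (card {w \<in> words l. length w = n \<and> card (occurrences p w) = k}) =
    int (card {w \<in> words l. length w = n \<and> card (occurrences (rev p) w) = k})" for n k
  proof -
    \<comment> \<open>Reversal is its own inverse and changes neither the number of cleared flags
      nor the number of blocks, hence not the sign.\<close>
    have "(\<Sum>Bs \<in> marked_block_lists l n k p. (- 1 :: int) ^ (unlinks (concat Bs) + length Bs)) =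
      (\<Sum>Bs \<in> marked_block_lists l n k (rev p). (- 1) ^ (unlinks (concat Bs) + length Bs))"
      using rev_in[of _ n k p] rev_in[of _ n k "rev p"]
      by (intro sum.reindex_bij_witness[of _ rev rev])
        (simp_all add: filter_concat length_concat flip: rev_map)
    then show ?thesis
      using ne sorted by (simp add: card_words_eq_signed_sum)
  qed
  then show ?thesis by (simp add: strongly_Wilf_equivalent_def)
qed

section \<open>Mirror and complement symmetries\<close>

text \<open>The letter at position \<open>i\<close> of \<open>w\<close> stands at
  \<open>n - 1 - i\<close> in \<open>rev w\<close>; blocks and their entries are reversed to make
  the positions increase again.\<close>

definition mirror_placement :: "nat \<Rightarrow> nat list list \<Rightarrow> nat list list" where
  "mirror_placement n iss = map rev (rev (map (map (\<lambda>i. n - 1 - i)) iss))"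

lemma concat_mirror_placement:
  "concat (mirror_placement n iss) = rev (map (\<lambda>i. n - 1 - i) (concat iss))"
  unfolding mirror_placement_def map_concat rev_concat ..

lemma mirror_placement:
  assumes "iss \<in> placements ms n"
  shows "mirror_placement n iss \<in> placements (rev ms) n"
    and "mirror_placement n (mirror_placement n iss) = iss"
proof -
  have less: "i < n" if "i \<in> set (concat iss)" for i
    using assms that by (auto simp: placements_def)
  have less': "i < n" if "b \<in> set iss" "i \<in> set b" for b i
    using less that by auto
  have "\<exists>s. rev (map (\<lambda>i. n - 1 - i) b) = [s..<s + length b]" if b: "b \<in> set iss" for b
  proof (cases "b = []")
    case False
    obtain s where s: "b = [s..<s + length b]" using assms b by (auto simp: placements_def)
    have "last b < n" using False b less' last_in_set by blast
    moreover have "last b = s + length b - 1"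
      using False by (subst s) (simp add: last_upt)
    \<comment> \<open>This bound keeps the left end \<open>n - (s + length b)\<close> of the
      mirrored interval from being truncated.\<close>
    ultimately have n: "s + length b \<le> n" by simp
    have "rev (map (\<lambda>i. n - 1 - i) [s..<s + length b]) = [n - (s + length b)..<n - (s + length b) + length b]"
      using n by (intro nth_equalityI) (auto simp: rev_nth)
    then show ?thesis using s by metis
  qed simp
  moreover have "map length (mirror_placement n iss) = rev (map length iss)"
    by (simp add: mirror_placement_def comp_def rev_map)
  moreover have "sorted_wrt (<) (concat (mirror_placement n iss))"
  proof -
    have "sorted_wrt (\<lambda>i j. n - 1 - j < n - 1 - i) (concat iss)"
    proof (rule sorted_wrt_mono_rel)
      show "sorted_wrt (<) (concat iss)" using assms by (simp add: placements_def)
      show "n - 1 - j < n - 1 - i" if "i \<in> set (concat iss)" "j \<in> set (concat iss)" "i < j" for i j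
        using less[OF that(2)] that(3) by simp
    qed
    then show ?thesis
      unfolding concat_mirror_placement by (simp only: sorted_wrt_rev sorted_wrt_map)
  qed
  moreover have "set (concat (mirror_placement n iss)) \<subseteq> {..<n}"
    unfolding concat_mirror_placement using less by fastforce
  ultimately show "mirror_placement n iss \<in> placements (rev ms) n"
    using assms by (auto simp: placements_def mirror_placement_def)
  have "map (\<lambda>i. n - 1 - (n - 1 - i)) b = b" if "b \<in> set iss" for b
    using less'[OF that] by (intro map_idI) fastforce
  then have "map (map (\<lambda>i. n - 1 - (n - 1 - i))) iss = iss" by (rule map_idI)
  then show "mirror_placement n (mirror_placement n iss) = iss"
    by (simp add: mirror_placement_def rev_map comp_def)
qed

lemma order_iso_mirror: "order_iso (map rev (rev p)) (map rev (rev vs)) \<longleftrightarrow> order_iso p vs"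
proof (cases "map length vs = map length p")
  case True
  then have "length (concat p) = length (concat vs)" by (simp add: length_concat)
  then have "set (zip (concat (map rev (rev p))) (concat (map rev (rev vs)))) = set (zip (concat p) (concat vs))"
    by (simp add: zip_rev flip: rev_concat)
  moreover have "map length (map rev (rev vs)) = map length (map rev (rev p))"
    using True by (simp add: comp_def flip: rev_map)
  ultimately show ?thesis using True by (simp add: order_iso_def)
next
  case False
  then show ?thesis by (simp add: order_iso_def comp_def flip: rev_map)
qed

lemma card_occurrences_mirror:
  assumes "[] \<notin> set p"
  shows "card (occurrences (map rev (rev p)) (rev w)) = card (occurrences p w)"
proof -
  let ?n = "length w" and ?p = "map rev (rev p)"
  have ne: "[] \<notin> set ?p" using assms by auto
  have entries: "map (map ((!) (rev w))) (mirror_placement ?n iss) = map rev (rev (map (map ((!) w)) iss))"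
    if "iss \<in> placements ms ?n" for iss ms
  proof -
    have "rev w ! (?n - 1 - i) = w ! i" if "i < ?n" for i
      using that by (simp add: rev_nth)
    moreover have "i < ?n" if "b \<in> set iss" "i \<in> set b" for b i
      using that \<open>iss \<in> placements ms ?n\<close> by (auto simp: placements_def)
    ultimately show ?thesis
      by (simp add: mirror_placement_def rev_map)
  qed
  have lens: "map length ?p = rev (map length p)" by (simp add: comp_def rev_map)
  have "bij_betw (mirror_placement ?n)
    {iss \<in> placements (map length p) ?n. order_iso p (map (map ((!) w)) iss)}
    {iss \<in> placements (map length ?p) (length (rev w)). order_iso ?p (map (map ((!) (rev w))) iss)}"
    (is "bij_betw _ ?A ?B")
  proof (rule bij_betw_byWitness[where f' = "mirror_placement ?n"])
    show "mirror_placement ?n ` ?A \<subseteq> ?B"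
    proof (intro image_subsetI)
      fix iss assume iss: "iss \<in> ?A"
      then have P: "iss \<in> placements (map length p) ?n" by simp
      show "mirror_placement ?n iss \<in> ?B"
        using iss mirror_placement(1)[OF P] unfolding mem_Collect_eq lens entries[OF P] order_iso_mirror
        by simp
    qed
    show "mirror_placement ?n ` ?B \<subseteq> ?A"
    proof (intro image_subsetI)
      fix iss assume iss: "iss \<in> ?B"
      then have P: "mirror_placement ?n iss \<in> placements (map length p) ?n"
        "mirror_placement ?n (mirror_placement ?n iss) = iss"
        using mirror_placement[of iss "rev (map length p)" ?n] unfolding lens by simp_all
      have "order_iso ?p (map rev (rev (map (map ((!) w)) (mirror_placement ?n iss))))"
        using iss entries[OF P(1)] P(2) by simp
      then show "mirror_placement ?n iss \<in> ?A" using P(1) by (simp add: order_iso_mirror)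
    qed
  qed (auto simp: mirror_placement(2))
  then have "card ?A = card ?B" by (rule bij_betw_same_card)
  then show ?thesis
    unfolding card_occurrences[OF assms] card_occurrences[OF ne] by (rule sym)
qed

text \<open>Below the bounds \<open>r\<close> and \<open>m\<close> natural subtraction is strictly
  decreasing. The condition for two pairs becomes the one with the pairs exchanged, and all ordered
  choices of two pairs are quantified over.\<close>

lemma order_iso_complement:
  assumes "set (concat p) \<subseteq> {..r}" "set (concat vs) \<subseteq> {..m}"
  shows "order_iso (map (map ((-) r)) p) (map (map ((-) m)) vs) \<longleftrightarrow> order_iso p vs"
proof -
  let ?Z = "set (zip (concat p) (concat vs))"
  have image: "set (zip (concat (map (map ((-) r)) p)) (concat (map (map ((-) m)) vs))) =
      (\<lambda>x. (r - fst x, m - snd x)) ` ?Z"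
    by (simp add: zip_map_map case_prod_beta flip: map_concat)
  have less: "m - snd x < m - snd y \<longleftrightarrow> snd y < snd x" "r - fst x < r - fst y \<longleftrightarrow> fst y < fst x"
    if "x \<in> ?Z" "y \<in> ?Z" for x y
  proof -
    have "fst x \<le> r" "fst y \<le> r" "snd x \<le> m" "snd y \<le> m"
      using assms that by (metis atMost_iff prod.collapse set_zip_leftD set_zip_rightD subsetD)+
    then show "m - snd x < m - snd y \<longleftrightarrow> snd y < snd x" "r - fst x < r - fst y \<longleftrightarrow> fst y < fst x"
      by auto
  qed
  have "(\<forall>x \<in> ?Z. \<forall>y \<in> ?Z. m - snd x < m - snd y \<longleftrightarrow> r - fst x < r - fst y) \<longleftrightarrow>
      (\<forall>x \<in> ?Z. \<forall>y \<in> ?Z. snd y < snd x \<longleftrightarrow> fst y < fst x)"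
    by (intro ball_cong refl) (simp only: less)
  also have "\<dots> \<longleftrightarrow> (\<forall>x \<in> ?Z. \<forall>y \<in> ?Z. snd x < snd y \<longleftrightarrow> fst x < fst y)"
    by blast
  finally show ?thesis
    unfolding order_iso_def image by (simp add: case_prod_beta comp_def)
qed

lemma card_occurrences_complement:
  assumes "[] \<notin> set p" "set (concat p) \<subseteq> {..r}" "set w \<subseteq> {..m}"
  shows "card (occurrences (map (map ((-) r)) p) (map ((-) m) w)) = card (occurrences p w)"
proof -
  let ?p = "map (map ((-) r)) p"
  have ne: "[] \<notin> set ?p" using assms(1) by auto
  have "order_iso ?p (map (map ((!) (map ((-) m) w))) iss) \<longleftrightarrow> order_iso p (map (map ((!) w)) iss)"
    if "iss \<in> placements (map length p) (length w)" for iss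
  proof -
    have less: "i < length w" if "b \<in> set iss" "i \<in> set b" for b i
      using that \<open>iss \<in> _\<close> by (auto simp: placements_def)
    then have "map (map ((!) (map ((-) m) w))) iss = map (map ((-) m)) (map (map ((!) w)) iss)"
      by simp
    moreover have "set (concat (map (map ((!) w)) iss)) \<subseteq> {..m}"
      using less assms(3) nth_mem by fastforce
    ultimately show ?thesis using assms(2) by (simp only: order_iso_complement)
  qed
  moreover have "map length ?p = map length p" by (simp add: comp_def)
  ultimately show ?thesis
    unfolding card_occurrences[OF assms(1)] card_occurrences[OF ne] by (metis (lifting) length_map)
qed

text \<open>As \<open>f\<close> is an involution, carrying occurrences of \<open>p\<close> to those
  of \<open>q\<close> gives the converse too, so \<open>f\<close> is its own inverse between the two
  sets of words.\<close>

lemma strongly_Wilf_equivalentI: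
  assumes "\<And>w. w \<in> F \<Longrightarrow> f w \<in> F \<and> f (f w) = w \<and> length (f w) = length w"
    and "\<And>w. w \<in> F \<Longrightarrow> card (occurrences q (f w)) = card (occurrences p w)"
  shows "strongly_Wilf_equivalent F p q"
  unfolding strongly_Wilf_equivalent_def
proof (intro allI)
  fix n k
  have "card (occurrences p (f w)) = card (occurrences q w)" if "w \<in> F" for w
    using assms that by metis
  then have "bij_betw f {w \<in> F. length w = n \<and> card (occurrences p w) = k}
      {w \<in> F. length w = n \<and> card (occurrences q w) = k}"
    using assms by (intro bij_betw_byWitness[where f' = f]) auto
  then show "card {w \<in> F. length w = n \<and> card (occurrences p w) = k} =
      card {w \<in> F. length w = n \<and> card (occurrences q w) = k}"
    by (rule bij_betw_same_card)
qed

lemma strongly_Wilf_equivalent_mirror: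
  assumes "[] \<notin> set p"
  shows "strongly_Wilf_equivalent (words l) p (map rev (rev p))"
  by (rule strongly_Wilf_equivalentI[of _ rev])
    (auto simp: words_def card_occurrences_mirror[OF assms])

lemma strongly_Wilf_equivalent_complement:
  assumes "[] \<notin> set p" "set (concat p) \<subseteq> {..r}"
  shows "strongly_Wilf_equivalent (words l) p (map (map ((-) r)) p)"
\<comment> \<open>Complementing in \<open>Suc l\<close> maps the alphabet \<open>{1..l}\<close> onto
  itself. The number \<open>r\<close> for the pattern can be chosen independently, because only
  relative order counts.\<close>
proof (rule strongly_Wilf_equivalentI[of _ "map ((-) (Suc l))"])
  fix w assume w: "w \<in> words l"
  then have "x \<le> Suc l" "x \<ge> 1" "x \<le> l" if "x \<in> set w" for x
    using that by (auto simp: words_def)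
  then show "map ((-) (Suc l)) w \<in> words l \<and> map ((-) (Suc l)) (map ((-) (Suc l)) w) = w \<and>
      length (map ((-) (Suc l)) w) = length w"
    by (fastforce simp: words_def intro!: map_idI)
  show "card (occurrences (map (map ((-) r)) p) (map ((-) (Suc l)) w)) = card (occurrences p w)"
    using assms w by (intro card_occurrences_complement) (auto simp: words_def)
qed

lemma strongly_Wilf_equivalent_trans [trans]:
  "strongly_Wilf_equivalent F p q \<Longrightarrow> strongly_Wilf_equivalent F q r \<Longrightarrow>
    strongly_Wilf_equivalent F p r"
  by (simp add: strongly_Wilf_equivalent_def)

section \<open>The nine families of equivalences\<close>

theorem corollary1p6:
  fixes l :: nat
  assumes "l \<ge> 1"
  shows "strongly_Wilf_equivalent (words l) [[1,3],[1,2]] [[1,2],[1,3]] \<and>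
    strongly_Wilf_equivalent (words l) [[1,2],[2,3]] [[2,1],[3,2]] \<and>
    strongly_Wilf_equivalent (words l) [[1,3],[2,4]] [[2,4],[1,3]] \<and>
    strongly_Wilf_equivalent (words l) [[1,2,3],[1]] [[3,2,1],[1]] \<and>
    strongly_Wilf_equivalent (words l) [[3,2,1],[1]] [[1,2,3],[3]] \<and>
    strongly_Wilf_equivalent (words l) [[1,2,4],[3]] [[4,2,1],[3]] \<and>
    strongly_Wilf_equivalent (words l) [[4,2,1],[3]] [[1,3,4],[2]] \<and>
    strongly_Wilf_equivalent (words l) [[1],[1,2],[2]] [[1],[2,1],[2]] \<and>
    strongly_Wilf_equivalent (words l) [[1],[1,3],[2]] [[1],[3,1],[2]] \<and>
    strongly_Wilf_equivalent (words l) [[2],[1,4],[3]] [[2],[4,1],[3]] \<and>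
    strongly_Wilf_equivalent (words l) [[1,2],[1],[1]] [[2,1],[1],[1]] \<and>
    strongly_Wilf_equivalent (words l) [[2,1],[1],[1]] [[1,2],[2],[2]]"
proof -
  let ?E = "strongly_Wilf_equivalent (words l)"
  \<comment> \<open>Reversing the order of the blocks and then the whole word restores the block
    order and reverses each block in place.\<close>
  have flip: "?E p (map rev p)"
    if "[] \<notin> set p" "\<forall>b \<in> set p. sorted_wrt (<) b" "successively overlapping p" for p
    using strongly_Wilf_equivalent_trans[OF strongly_Wilf_equivalent_rev_blocks[OF that]
        strongly_Wilf_equivalent_mirror[of "rev p"]] that(1)
    by (simp add: rev_map)
  have complement: "?E p (map (map ((-) r)) p)" if "[] \<notin> set p" "\<forall>x \<in> set (concat p). x \<le> r" for p r
    using that by (intro strongly_Wilf_equivalent_complement) auto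
  have "?E [[1,3],[1,2]] [[1,2],[1,3]]" "?E [[1,3],[2,4]] [[2,4],[1,3]]"
    using strongly_Wilf_equivalent_rev_blocks[of "[[1,3],[1,2]]" l]
      strongly_Wilf_equivalent_rev_blocks[of "[[1,3],[2,4]]" l]
    by (simp_all add: overlapping_def)
  moreover have "?E [[1,2],[2,3]] [[2,1],[3,2]]" "?E [[1,2,3],[1]] [[3,2,1],[1]]"
      "?E [[1,2,4],[3]] [[4,2,1],[3]]" "?E [[1],[1,2],[2]] [[1],[2,1],[2]]"
      "?E [[1],[1,3],[2]] [[1],[3,1],[2]]" "?E [[2],[1,4],[3]] [[2],[4,1],[3]]"
      "?E [[1,2],[1],[1]] [[2,1],[1],[1]]"
    using flip[of "[[1,2],[2,3]]"] flip[of "[[1,2,3],[1]]"] flip[of "[[1,2,4],[3]]"]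
      flip[of "[[1],[1,2],[2]]"] flip[of "[[1],[1,3],[2]]"] flip[of "[[2],[1,4],[3]]"]
      flip[of "[[1,2],[1],[1]]"]
    by (simp_all add: overlapping_def)
  \<comment> \<open>The numbers 4, 5 and 3 below are one more than the largest letter, so the
    complemented letters start at 1 again.\<close>
  moreover have "?E [[3,2,1],[1]] [[1,2,3],[3]]" "?E [[4,2,1],[3]] [[1,3,4],[2]]"
      "?E [[2,1],[1],[1]] [[1,2],[2],[2]]"
    using complement[of "[[3,2,1],[1]]" 4] complement[of "[[4,2,1],[3]]" 5]
      complement[of "[[2,1],[1],[1]]" 3]
    by simp_all
  ultimately show ?thesis by blast
qed

end
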